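(* Let $d\ge1$ be an integer and let $X$ be a compact $d$-manifold (or any compact metric space having upper Minkowski dimension $d$ and admitting a bi-Lipschitz embedding of the Euclidean cube $I^d$). Then the space $\mathscr{C}(X)$ of closed subsets of $X$, endowed with the Hausdorff metric, has power-exponential size and more precisely \[\mathrm{crit}_{\mathscr{P}}\,\mathscr{C}(X)=d.\]
   Context: For $f:[0,T)\to[0,+\infty)$ continuous non-decreasing with $f(0)=0$ and a subset $A$ of a Polish metric space, let $\Lambda_f(A)=\lim_{\delta\to0}\inf\big\{\sum_{i=1}^\infty f(\operatorname{diam}E_i): A\subset\bigcup_iE_i,\ \operatorname{diam}E_i\le\delta,\ E_i\text{ closed}\big\}$. The power-exponential scale is $\mathscr{P}=(f_s)_{s\in(0,+\infty)}$ with $f_s(r)=e^{-(1/r)^s}$ for $r>0$, $f_s(0)=0$. The critical parameter of $A$ is $\mathrm{crit}_{\mathscr P}A=\sup\{s>0:\Lambda_{f_s}(A)>0\}=\inf\{s>0:\Lambda_{f_s}(A)=0\}\in[0,+\infty]$ (with $\sup\emptyset=0$, $\inf\emptyset=+\infty$); for a space, $A$ is the whole space. A space has power-exponential size if $0<\mathrm{crit}_{\mathscr P}<+\infty$. $I=[0,1]$ and $I^d$ carries the Euclidean metric; bi-Lipschitz embeddings are maps $g$ with $C^{-1}\mathrm{dist}(x,x')\le\mathrm{dist}(g(x),g(x'))\le C\,\mathrm{dist}(x,x')$ for some $C\ge1$. "Manifold" means a manifold with a metric (e.g. a Riemannian distance) locally bi-Lipschitz equivalent to the Euclidean one in charts.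 The upper Minkowski dimension of a compact $X$ is $\limsup_{\varepsilon\to0}\frac{\log N(X,\varepsilon)}{\log(1/\varepsilon)}$, with $N(X,\varepsilon)$ the minimal number of balls of radius $\varepsilon$ covering $X$. Closed subsets are taken non-empty, so that the Hausdorff metric is finite. *)

theory Defs
  imports "HOL-Analysis.Analysis"
begin

section \<open>Gauge measures and the power-exponential critical parameter\<close>

definition mdiam :: "'a metric \<Rightarrow> 'a set \<Rightarrow> real" where
  "mdiam m E = (if E = {} then 0 else SUP (x, y)\<in>E \<times> E. mdist m x y)"

text \<open>Boundedness is required explicitly because the real-valued supremum in
  \<^const>\<open>mdiam\<close> is unspecified on unbounded sets.  The sets may be empty, so finite
  covers are included.\<close>

definition fine_covers :: "'a metric \<Rightarrow> 'a set \<Rightarrow> real \<Rightarrow> (nat \<Rightarrow> 'a set) set" where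
  "fine_covers m A \<delta> =
     {E. A \<subseteq> (\<Union>i. E i) \<and>
         (\<forall>i. closedin (mtopology_of m) (E i) \<and>
              Metric_space.mbounded (mspace m) (mdist m) (E i) \<and>
              mdiam m (E i) \<le> \<delta>)}"

definition Lambda_pre :: "'a metric \<Rightarrow> (real \<Rightarrow> real) \<Rightarrow> 'a set \<Rightarrow> real \<Rightarrow> ennreal" where
  "Lambda_pre m f A \<delta> = (INF E\<in>fine_covers m A \<delta>. \<Sum>i. ennreal (f (mdiam m (E i))))"

definition Lambda :: "'a metric \<Rightarrow> (real \<Rightarrow> real) \<Rightarrow> 'a set \<Rightarrow> ennreal" where
  "Lambda m f A = Lim (at_right 0) (Lambda_pre m f A)"

definition pow_exp :: "real \<Rightarrow> real \<Rightarrow> real" where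
  "pow_exp s r = (if r > 0 then exp (- ((1 / r) powr s)) else 0)"

text \<open>In \<^typ>\<open>ennreal\<close> the supremum of the empty set is 0, as the convention requires.\<close>

definition crit :: "'a metric \<Rightarrow> 'a set \<Rightarrow> ennreal" where
  "crit m A = Sup (ennreal ` {s. s > 0 \<and> Lambda m (pow_exp s) A > 0})"

definition power_exponential_size :: "'a metric \<Rightarrow> bool" where
  "power_exponential_size m \<longleftrightarrow> 0 < crit m (mspace m) \<and> crit m (mspace m) < \<infinity>"

lemma Lambda_pre_mono:
  assumes "\<delta> \<le> \<delta>'"
  shows "Lambda_pre m f A \<delta>' \<le> Lambda_pre m f A \<delta>"
  unfolding Lambda_pre_def
  by (rule INF_superset_mono) (use assms in \<open>auto simp: fine_covers_def intro: order_trans\<close>)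

text \<open>The limit defining \<^const>\<open>Lambda\<close> exists for every \<open>f\<close> and \<open>A\<close>.\<close>

lemma Lambda_pre_tendsto_SUP:
  "(Lambda_pre m f A \<longlongrightarrow> (SUP \<delta>\<in>{0<..}. Lambda_pre m f A \<delta>)) (at_right 0)"
proof (rule order_tendstoI)
  fix a assume "a < (SUP \<delta>\<in>{0<..}. Lambda_pre m f A \<delta>)"
  then obtain \<delta> where d: "\<delta> > 0" "a < Lambda_pre m f A \<delta>"
    by (auto simp: less_SUP_iff)
  have "a < Lambda_pre m f A e" if "e < \<delta>" for e
    using d(2) Lambda_pre_mono[of e \<delta> m f A] that by (meson less_imp_le less_le_trans)
  then show "\<forall>\<^sub>F e in at_right 0. a < Lambda_pre m f A e"
    using d(1) by (auto simp: eventually_at_right_field)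
next
  fix a assume a: "(SUP \<delta>\<in>{0<..}. Lambda_pre m f A \<delta>) < a"
  have "Lambda_pre m f A e < a" if "e > 0" for e
    using that by (intro le_less_trans[OF _ a] SUP_upper) auto
  then show "\<forall>\<^sub>F e in at_right 0. Lambda_pre m f A e < a"
    by (auto simp: eventually_at_right_field intro: exI[of _ 1])
qed

lemma Lambda_eq_SUP: "Lambda m f A = (SUP \<delta>\<in>{0<..}. Lambda_pre m f A \<delta>)"
  unfolding Lambda_def by (rule tendsto_Lim[OF _ Lambda_pre_tendsto_SUP]) simp

lemma mdiam_nonneg:
  assumes "Metric_space.mbounded (mspace m) (mdist m) E"
  shows "0 \<le> mdiam m E"
proof (cases "E = {}")
  case False
  then obtain x where x: "x \<in> E" by auto
  have bdd: "bdd_above ((\<lambda>(x, y). mdist m x y) ` (E \<times> E))"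
    using assms Metric_space.mbounded_alt[OF Metric_space_mspace_mdist[of m]]
    by (fastforce simp: bdd_above_def)
  have "mdist m x x \<le> mdiam m E"
    unfolding mdiam_def using False cSUP_upper[OF _ bdd, of "(x, x)"] x by auto
  then show ?thesis
    by (meson mdist_nonneg order_trans)
qed (simp add: mdiam_def)

lemma pow_exp_antimono:
  assumes "s \<le> t" "r \<le> 1"
  shows "pow_exp t r \<le> pow_exp s r"
  using assms by (auto simp: pow_exp_def intro!: powr_mono)

lemma Lambda_pow_exp_antimono:
  assumes "s \<le> t"
  shows "Lambda m (pow_exp t) A \<le> Lambda m (pow_exp s) A"
proof -
  have *: "Lambda_pre m (pow_exp t) A \<delta> \<le> Lambda_pre m (pow_exp s) A \<delta>" if "\<delta> \<le> 1" for \<delta>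
    unfolding Lambda_pre_def
    by (rule INF_mono, rule bexI, rule suminf_le)
       (use that assms in \<open>auto simp: fine_covers_def intro!: ennreal_leI pow_exp_antimono
          intro: order_trans\<close>)
  have "Lambda_pre m (pow_exp t) A \<delta> \<le> Lambda m (pow_exp s) A" if "\<delta> > 0" for \<delta>
  proof -
    have "Lambda_pre m (pow_exp t) A \<delta> \<le> Lambda_pre m (pow_exp t) A (min \<delta> 1)"
      by (rule Lambda_pre_mono) simp
    also have "\<dots> \<le> Lambda_pre m (pow_exp s) A (min \<delta> 1)"
      by (rule *) simp
    also have "\<dots> \<le> Lambda m (pow_exp s) A"
      unfolding Lambda_eq_SUP using that by (intro SUP_upper) auto
    finally show ?thesis .
  qed
  then show ?thesis
    unfolding Lambda_eq_SUP[of m "pow_exp t"] by (auto intro: SUP_least)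
qed

lemma crit_eq_Inf:
  "crit m A = Inf (ennreal ` {s. s > 0 \<and> Lambda m (pow_exp s) A = 0})"
proof (rule antisym)
  show "crit m A \<le> Inf (ennreal ` {s. s > 0 \<and> Lambda m (pow_exp s) A = 0})"
    unfolding crit_def
  proof (rule Sup_least, rule Inf_greatest, clarify)
    fix s t :: real
    assume "0 < Lambda m (pow_exp s) A" "Lambda m (pow_exp t) A = 0" "0 < t"
    then have "\<not> t \<le> s"
      using Lambda_pow_exp_antimono[of t s m A] by auto
    then show "ennreal s \<le> ennreal t"
      by (intro ennreal_leI) simp
  qed
next
  show "Inf (ennreal ` {s. s > 0 \<and> Lambda m (pow_exp s) A = 0}) \<le> crit m A"
  proof (rule ccontr)
    assume "\<not> ?thesis"
    then have lt: "crit m A < Inf (ennreal ` {s. s > 0 \<and> Lambda m (pow_exp s) A = 0})"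
      by simp
    then obtain z where z: "crit m A < z"
        "z < Inf (ennreal ` {s. s > 0 \<and> Lambda m (pow_exp s) A = 0})"
      using dense by blast
    then obtain r where r: "z = ennreal r" "r \<ge> 0"
      by (cases z) auto
    have "r > 0"
      using z(1) r by (cases "r = 0") auto
    show False
    proof (cases "Lambda m (pow_exp r) A = 0")
      case True
      then have "Inf (ennreal ` {s. s > 0 \<and> Lambda m (pow_exp s) A = 0}) \<le> ennreal r"
        using \<open>r > 0\<close> by (intro Inf_lower) auto
      then show False using z(2) r by simp
    next
      case False
      then have "ennreal r \<le> crit m A"
        unfolding crit_def using \<open>r > 0\<close> by (intro Sup_upper) (auto simp: zero_less_iff_neq_zero)
      then show False using z(1) r by simp
    qed
  qed
qed


section \<open>The hyperspace of closed subsets\<close>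

text \<open>The value 0 in the degenerate cases is a convention; without it the abstract
  \<^locale>\<open>Metric_space\<close> axioms, some of which are not relativised to the carrier, would fail.\<close>

definition hausdorff_dist :: "'a::metric_space set \<Rightarrow> 'a set \<Rightarrow> real" where
  "hausdorff_dist K L =
     (if K \<noteq> {} \<and> L \<noteq> {} \<and> bounded K \<and> bounded L
      then max (SUP x\<in>K. infdist x L) (SUP y\<in>L. infdist y K) else 0)"

definition closed_subsets :: "'a::metric_space set \<Rightarrow> 'a set set" where
  "closed_subsets X = {K. closedin (top_of_set X) K \<and> K \<noteq> {}}"

definition hyperspace :: "'a::metric_space set \<Rightarrow> 'a set metric" where
  "hyperspace X = metric (closed_subsets X, hausdorff_dist)"

lemma closed_subsets_compact:
  assumes "compact X" "K \<in> closed_subsets X"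
  shows "compact K" "K \<noteq> {}"
  using assms closedin_compact[of X K] by (auto simp: closed_subsets_def)

lemma bdd_above_infdist:
  assumes "bounded K" "L \<noteq> {}"
  shows "bdd_above ((\<lambda>x. infdist x L) ` K)"
proof -
  obtain a where a: "a \<in> L" using assms by blast
  obtain B where B: "\<And>x. x \<in> K \<Longrightarrow> dist a x \<le> B"
    using assms(1) bounded_any_center[of K a] by auto
  have "infdist x L \<le> B" if "x \<in> K" for x
    using infdist_le[OF a, of x] B[OF that] by (simp add: dist_commute)
  then show ?thesis by (auto simp: bdd_above_def)
qed

lemma infdist_le_hausdorff_dist:
  assumes "bounded K" "bounded L" "L \<noteq> {}" "x \<in> K"
  shows "infdist x L \<le> hausdorff_dist K L"
  using assms cSUP_upper[OF assms(4) bdd_above_infdist[OF assms(1,3)]]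
  by (auto simp: hausdorff_dist_def)

lemma hausdorff_dist_commute: "hausdorff_dist K L = hausdorff_dist L K"
  by (auto simp: hausdorff_dist_def max.commute)

lemma hausdorff_dist_nonneg: "0 \<le> hausdorff_dist K L"
proof (cases "K \<noteq> {} \<and> L \<noteq> {} \<and> bounded K \<and> bounded L")
  case True
  then obtain x where "x \<in> K" by auto
  then show ?thesis
    using infdist_le_hausdorff_dist[of K L x] infdist_nonneg[of x L] True by linarith
qed (auto simp: hausdorff_dist_def)

lemma hausdorff_dist_le:
  assumes "K \<noteq> {}" "L \<noteq> {}" "bounded K" "bounded L"
    and "\<And>x. x \<in> K \<Longrightarrow> infdist x L \<le> B" "\<And>y. y \<in> L \<Longrightarrow> infdist y K \<le> B"
  shows "hausdorff_dist K L \<le> B"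
  using assms by (auto simp: hausdorff_dist_def intro!: cSUP_least)

lemma infdist_triangle_hausdorff:
  assumes "bounded K" "compact L" "L \<noteq> {}" "bounded M" "M \<noteq> {}" "x \<in> K"
  shows "infdist x M \<le> hausdorff_dist K L + hausdorff_dist L M"
proof -
  obtain y where y: "y \<in> L" "infdist x L = dist x y"
  proof -
    have "continuous_on L (dist x)" by (intro continuous_intros)
    then obtain y where y: "y \<in> L" "\<forall>z\<in>L. dist x y \<le> dist x z"
      using continuous_attains_inf[OF assms(2,3)] by blast
    then have "infdist x L = dist x y"
      using infdist_le[OF y(1), of x] assms(3)
      by (auto simp: infdist_def intro!: antisym cINF_greatest)
    with y(1) show thesis by (rule that)
  qed
  have "infdist x M \<le> infdist y M + dist x y"
    by (rule infdist_triangle)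
  with y infdist_le_hausdorff_dist[of K L x] infdist_le_hausdorff_dist[of L M y] assms
  show ?thesis by (auto dest: compact_imp_bounded)
qed

lemma Metric_space_hyperspace:
  fixes X :: "'a::metric_space set"
  assumes X: "compact X"
  shows "Metric_space (closed_subsets X) hausdorff_dist"
proof
  fix K L M :: "'a set"
  note c = closed_subsets_compact[OF X]
  note b = compact_imp_bounded
  show "0 \<le> hausdorff_dist K L" by (rule hausdorff_dist_nonneg)
  show "hausdorff_dist K L = hausdorff_dist L K" by (rule hausdorff_dist_commute)
  assume K: "K \<in> closed_subsets X" and L: "L \<in> closed_subsets X"
  note cK = c[OF K] and cL = c[OF L]
  show "hausdorff_dist K L = 0 \<longleftrightarrow> K = L"
  proof
    assume 0: "hausdorff_dist K L = 0"
    have "x \<in> L" if "x \<in> K" for x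
      using infdist_le_hausdorff_dist[of K L x] 0 that cK cL infdist_nonneg[of x L]
        in_closed_iff_infdist_zero[of L x] by (auto simp: b compact_imp_closed)
    moreover have "x \<in> K" if "x \<in> L" for x
      using infdist_le_hausdorff_dist[of L K x] 0 that cK cL infdist_nonneg[of x K]
        in_closed_iff_infdist_zero[of K x] hausdorff_dist_commute[of K L]
      by (auto simp: b compact_imp_closed)
    ultimately show "K = L" by blast
  next
    assume "K = L"
    then have "hausdorff_dist K L \<le> 0"
      using cK by (intro hausdorff_dist_le) (auto simp: b)
    then show "hausdorff_dist K L = 0"
      using hausdorff_dist_nonneg[of K L] by linarith
  qed
  assume M: "M \<in> closed_subsets X"
  note cM = c[OF M]
  show "hausdorff_dist K M \<le> hausdorff_dist K L + hausdorff_dist L M"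
  proof (rule hausdorff_dist_le)
    fix y assume "y \<in> M"
    then have "infdist y K \<le> hausdorff_dist M L + hausdorff_dist L K"
      using cK cL cM by (intro infdist_triangle_hausdorff) (auto simp: b)
    then show "infdist y K \<le> hausdorff_dist K L + hausdorff_dist L M"
      by (simp add: hausdorff_dist_commute)
  qed (use cK cL cM in \<open>auto simp: b intro!: infdist_triangle_hausdorff\<close>)
qed

lemma mspace_hyperspace: "compact X \<Longrightarrow> mspace (hyperspace X) = closed_subsets X"
  and mdist_hyperspace: "compact X \<Longrightarrow> mdist (hyperspace X) = hausdorff_dist"
  using Metric_space.mspace_metric[OF Metric_space_hyperspace]
    Metric_space.mdist_metric[OF Metric_space_hyperspace]
  by (auto simp: hyperspace_def)


section \<open>Bi-Lipschitz maps, manifolds and Minkowski dimension\<close>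

definition bi_lipschitz_on :: "'a::metric_space set \<Rightarrow> ('a \<Rightarrow> 'b::metric_space) \<Rightarrow> bool" where
  "bi_lipschitz_on S g \<longleftrightarrow>
     (\<exists>C\<ge>1. \<forall>x\<in>S. \<forall>y\<in>S. inverse C * dist x y \<le> dist (g x) (g y) \<and>
                             dist (g x) (g y) \<le> C * dist x y)"

text \<open>A manifold without boundary, of dimension \<^term>\<open>CARD('n)\<close>, with a metric locally
  bi-Lipschitz equivalent to the Euclidean one: every point has an open neighbourhood
  \<open>U\<close> in \<open>X\<close> and a bi-Lipschitz chart of \<open>U\<close> onto an open set of \<^typ>\<open>real^'n\<close>; such a
  chart is automatically a homeomorphism onto its image.\<close>

definition metric_manifold :: "'n::finite itself \<Rightarrow> 'a::metric_space set \<Rightarrow> bool" where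
  "metric_manifold (_ :: 'n itself) X \<longleftrightarrow>
     (\<forall>x\<in>X. \<exists>U (\<phi> :: 'a \<Rightarrow> real^'n).
        openin (top_of_set X) U \<and> x \<in> U \<and> open (\<phi> ` U) \<and> bi_lipschitz_on U \<phi>)"

definition covering_number :: "'a::metric_space set \<Rightarrow> real \<Rightarrow> nat" where
  "covering_number X \<epsilon> =
     (LEAST n. \<exists>S. S \<subseteq> X \<and> finite S \<and> card S = n \<and> X \<subseteq> (\<Union>x\<in>S. ball x \<epsilon>))"

definition upper_Minkowski_dim :: "'a::metric_space set \<Rightarrow> ereal" where
  "upper_Minkowski_dim X =
     Limsup (at_right 0) (\<lambda>\<epsilon>. ereal (ln (real (covering_number X \<epsilon>)) / ln (1 / \<epsilon>)))"

end

theory Submission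
  imports
    Defs
    "HOL-Probability.Infinite_Product_Measure"
    "HOL-Probability.Probability_Mass_Function"
    "HOL-Real_Asymp.Real_Asymp"
begin

text \<open>Write \<open>n\<close> for the dimension. The two inequalities for the critical parameter are independent.

\<^bold>\<open>At most \<open>n\<close>.\<close> For every \<open>t > n\<close> and all small \<open>\<epsilon>\<close>, the space \<open>X\<close> is covered by at most
\<open>\<epsilon> powr -t\<close> balls of radius \<open>\<epsilon>\<close>: this is the definition of the Minkowski dimension, and for a
manifold it follows by subdividing the images of finitely many charts into small cubes
(\<open>covered_by_Minkowski\<close>, \<open>covered_by_manifold\<close>). A closed subset of \<open>X\<close> is determined up to
Hausdorff distance \<open>\<epsilon>\<close> by the set of centres near it, so the hyperspace is covered by
\<open>2 powr (\<epsilon> powr -t)\<close> closed sets of diameter at most \<open>2\<epsilon>\<close>. For \<open>s > t\<close> this number times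
\<open>exp (- (1 / (2\<epsilon>)) powr s)\<close> tends to \<open>0\<close> (\<open>Lambda_hyperspace_eq_0\<close>).

\<^bold>\<open>At least \<open>n\<close>.\<close> Either hypothesis gives a bi-Lipschitz copy of the cube in \<open>X\<close>. In the cube take the
disjoint boxes \<open>{2 powr -(j+1) <.. 2 powr -j}\<close> in each coordinate, which shrink to the corner \<open>0\<close>,
and put into the \<open>j\<close>-th one a regular grid with \<open>B ^ j\<close> points per side. Let \<open>P\<close> be the union of
these grids. A point of the \<open>j\<close>-th grid has distance at least \<open>\<rho>\<^sub>j = 1 / (2 (2B) ^ j)\<close> from all
other points of \<open>P\<close> and from \<open>0\<close>, and as \<open>0\<close> is the only accumulation point of \<open>P\<close>, every subset
of \<open>P\<close> becomes compact once \<open>0\<close> is added. Choose such a subset by tossing a fair coin for each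
point. Two outcomes that differ on the \<open>j\<close>-th grid give sets at Hausdorff distance at least
\<open>\<rho>\<^sub>j\<close>, up to the Lipschitz constant. Hence a family of closed sets of diameter below \<open>\<rho>\<^sub>j\<close> fixes
all \<open>B ^ (j n)\<close> coins of the \<open>j\<close>-th grid and has probability at most \<open>2 ^ -(B ^ (j n))\<close>. The
diameter may be as small as \<open>\<rho>\<^sub>j / (2B)\<close>, so this is dominated by the gauge if
\<open>B ^ (j n)\<close> beats \<open>((2B) ^ j) powr s\<close>, that is, if \<open>B powr (n - s) > 2 powr s\<close>. This holds for
\<open>B\<close> large as soon as \<open>s < n\<close>, and the mass distribution principle
(\<open>Lambda_pos_mass_distribution\<close>) then gives positive measure.\<close>

section \<open>Bounds for gauge measures\<close>

lemma mdist_le_mdiam: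
  assumes "Metric_space.mbounded (mspace m) (mdist m) E" "x \<in> E" "y \<in> E"
  shows "mdist m x y \<le> mdiam m E"
proof -
  have "bdd_above ((\<lambda>(x, y). mdist m x y) ` (E \<times> E))"
    using assms(1) Metric_space.mbounded_alt[OF Metric_space_mspace_mdist[of m]]
    by (fastforce simp: bdd_above_def)
  from cSUP_upper[OF _ this, of "(x, y)"] show ?thesis
    using assms(2,3) by (auto simp: mdiam_def)
qed

lemma mdiam_le:
  assumes "\<And>x y. x \<in> E \<Longrightarrow> y \<in> E \<Longrightarrow> mdist m x y \<le> B" "0 \<le> B"
  shows "mdiam m E \<le> B"
  using assms by (auto simp: mdiam_def intro!: cSUP_least)

lemma pow_exp_mono:
  assumes "0 \<le> s" "r \<le> r'"
  shows "pow_exp s r \<le> pow_exp s r'"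
  using assms by (auto simp: pow_exp_def frac_le intro!: powr_mono2)

lemma Lambda_pre_finite_cover:
  assumes "finite F" "A \<subseteq> \<Union>F"
    and "\<And>E. E \<in> F \<Longrightarrow> closedin (mtopology_of m) E \<and>
           Metric_space.mbounded (mspace m) (mdist m) E \<and> mdiam m E \<le> \<delta> \<and> f (mdiam m E) \<le> b"
    and "f 0 = 0" "0 \<le> \<delta>" "0 \<le> b"
  shows "Lambda_pre m f A \<delta> \<le> ennreal (real (card F) * b)"
proof -
  obtain h where h: "bij_betw h {0..<card F} F"
    using ex_bij_betw_nat_finite[OF assms(1)] by blast
  define E where "E i = (if i < card F then h i else {})" for i
  have hF: "h i \<in> F" if "i < card F" for i
    using h that by (auto simp: bij_betw_def)
  have mb: "Metric_space.mbounded (mspace m) (mdist m) {}"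
    by (rule Metric_space.mbounded_empty[OF Metric_space_mspace_mdist])
  have m0: "mdiam m {} = 0" by (simp add: mdiam_def)
  have "x \<in> (\<Union>i. E i)" if x: "x \<in> A" for x
  proof -
    obtain D where "D \<in> F" "x \<in> D" using x assms(2) by blast
    then obtain i where "i < card F" "h i = D"
      using h by (metis atLeastLessThan_iff bij_betw_iff_bijections)
    then show ?thesis using \<open>x \<in> D\<close> by (auto simp: E_def)
  qed
  moreover have "closedin (mtopology_of m) (E i) \<and>
      Metric_space.mbounded (mspace m) (mdist m) (E i) \<and> mdiam m (E i) \<le> \<delta>" for i
    using assms(3)[OF hF, of i] assms(5) mb m0 by (cases "i < card F") (simp_all add: E_def)
  ultimately have "E \<in> fine_covers m A \<delta>"
    unfolding fine_covers_def by blast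
  then have "Lambda_pre m f A \<delta> \<le> (\<Sum>i. ennreal (f (mdiam m (E i))))"
    unfolding Lambda_pre_def by (rule INF_lower)
  also have "\<dots> = (\<Sum>i<card F. ennreal (f (mdiam m (E i))))"
    by (rule suminf_finite) (auto simp: E_def m0 assms(4))
  also have "\<dots> \<le> (\<Sum>i<card F. ennreal b)"
    using assms(3)[OF hF] by (intro sum_mono ennreal_leI) (simp add: E_def)
  also have "\<dots> = ennreal (real (card F) * b)"
    using assms(6) by (simp add: ennreal_mult ennreal_of_nat_eq_real_of_nat)
  finally show ?thesis .
qed

text \<open>The mass distribution principle: if \<open>K\<close> is a random point of \<open>A\<close> and a set of small diameter \<open>r\<close>
is hit with probability at most \<open>f r\<close>, then summing over any cover of \<open>A\<close> gives at least \<open>1\<close>.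
Only an outer bound \<open>B\<close> for the event of hitting \<open>E\<close> is demanded, so that \<open>K\<close> need not be
measurable for the Borel sets of \<open>m\<close>.\<close>

lemma Lambda_pos_mass_distribution:
  assumes M: "prob_space M" and K: "\<And>\<omega>. \<omega> \<in> space M \<Longrightarrow> K \<omega> \<in> A" and "0 < \<delta>"
    and mass: "\<And>E. \<lbrakk>E \<subseteq> mspace m; Metric_space.mbounded (mspace m) (mdist m) E; mdiam m E \<le> \<delta>\<rbrakk>
       \<Longrightarrow> \<exists>B\<in>sets M. {\<omega> \<in> space M. K \<omega> \<in> E} \<subseteq> B \<and> emeasure M B \<le> ennreal (f (mdiam m E))"
  shows "0 < Lambda m f A"
proof -
  interpret prob_space M by (rule M)
  have "1 \<le> Lambda_pre m f A \<delta>"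
    unfolding Lambda_pre_def
  proof (rule INF_greatest)
    fix E assume E: "E \<in> fine_covers m A \<delta>"
    have Em: "E i \<subseteq> mspace m" for i
      using E closedin_subset[of "mtopology_of m" "E i"] by (simp add: fine_covers_def)
    have "\<exists>B\<in>sets M. {\<omega> \<in> space M. K \<omega> \<in> E i} \<subseteq> B \<and> emeasure M B \<le> ennreal (f (mdiam m (E i)))" for i
      using E Em by (intro mass) (auto simp: fine_covers_def)
    then obtain B where B: "\<And>i. B i \<in> sets M" "\<And>i. {\<omega> \<in> space M. K \<omega> \<in> E i} \<subseteq> B i"
        "\<And>i. emeasure M (B i) \<le> ennreal (f (mdiam m (E i)))"
      by metis
    have "space M \<subseteq> (\<Union>i. B i)"
    proof
      fix \<omega> assume \<omega>: "\<omega> \<in> space M"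
      have "A \<subseteq> (\<Union>i. E i)" using E by (simp add: fine_covers_def)
      then obtain i where "K \<omega> \<in> E i" using K[OF \<omega>] by blast
      then show "\<omega> \<in> (\<Union>i. B i)" using B(2) \<omega> by blast
    qed
    then have "1 \<le> emeasure M (\<Union>i. B i)"
      using emeasure_mono[of "space M" "\<Union>i. B i" M] B(1) by (auto simp: emeasure_space_1)
    also have "\<dots> \<le> (\<Sum>i. emeasure M (B i))"
      using B(1) by (intro emeasure_subadditive_countably) auto
    also have "\<dots> \<le> (\<Sum>i. ennreal (f (mdiam m (E i))))"
      using B(3) by (intro suminf_le) auto
    finally show "1 \<le> (\<Sum>i. ennreal (f (mdiam m (E i))))" .
  qed
  also have "\<dots> \<le> Lambda m f A"
    unfolding Lambda_eq_SUP using \<open>0 < \<delta>\<close> by (intro SUP_upper) auto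
  finally show ?thesis by (meson less_le_trans zero_less_one)
qed

section \<open>Coverings by small balls\<close>

text \<open>The bound \<open>N\<close> is real so that it can be a power of \<open>1 / \<epsilon>\<close>. Closed balls suit pieces whose points
have mutual distance at most \<open>\<epsilon>\<close>, such as the preimages of small cubes.\<close>

definition covered_by :: "'a::metric_space set \<Rightarrow> real \<Rightarrow> real \<Rightarrow> bool" where
  "covered_by X \<epsilon> N \<longleftrightarrow>
     (\<exists>S. S \<subseteq> X \<and> finite S \<and> real (card S) \<le> N \<and> X \<subseteq> (\<Union>x\<in>S. cball x \<epsilon>))"

lemma covered_by_mono: "covered_by X \<epsilon> N \<Longrightarrow> N \<le> N' \<Longrightarrow> covered_by X \<epsilon> N'"
  unfolding covered_by_def by (meson order_trans)

lemma covered_by_fibres: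
  assumes T: "finite T" "f ` X \<subseteq> T" "real (card T) \<le> N"
    and f: "\<And>x y. x \<in> X \<Longrightarrow> y \<in> X \<Longrightarrow> f x = f y \<Longrightarrow> dist x y \<le> \<epsilon>"
  shows "covered_by X \<epsilon> N"
proof -
  let ?r = "inv_into X f"
  let ?S = "?r ` f ` X"
  have fin: "finite (f ` X)" using T finite_subset by blast
  have "card ?S \<le> card T"
    using card_image_le[OF fin, of ?r] card_mono[OF T(1,2)] by linarith
  moreover have "?S \<subseteq> X" by (auto intro: inv_into_into)
  moreover have "X \<subseteq> (\<Union>x\<in>?S. cball x \<epsilon>)"
    by (auto intro!: bexI f inv_into_into simp: f_inv_into_f)
  ultimately show ?thesis
    unfolding covered_by_def using fin T(3) by (intro exI[of _ ?S]) auto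
qed

text \<open>The image of the chart is bounded, hence meets \<open>O(\<epsilon> powr -n)\<close> cubes of side \<open>\<epsilon> / (C n)\<close>;
by the lower Lipschitz bound the preimage of each cube has diameter at most \<open>\<epsilon>\<close>.\<close>

lemma covered_by_bi_lipschitz_chart:
  fixes \<phi> :: "'a::metric_space \<Rightarrow> real^'n"
  assumes U: "bounded U" and \<phi>: "bi_lipschitz_on U \<phi>"
  shows "\<exists>c>0. \<forall>\<epsilon>. 0 < \<epsilon> \<and> \<epsilon> \<le> 1 \<longrightarrow> covered_by U \<epsilon> (c * \<epsilon> powr (- real CARD('n)))"
proof -
  let ?n = "CARD('n)"
  obtain C where C: "C \<ge> 1"
    and lo: "\<And>x y. x \<in> U \<Longrightarrow> y \<in> U \<Longrightarrow> dist x y \<le> C * dist (\<phi> x) (\<phi> y)"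
    and hi: "\<And>x y. x \<in> U \<Longrightarrow> y \<in> U \<Longrightarrow> dist (\<phi> x) (\<phi> y) \<le> C * dist x y"
    using \<phi> by (auto simp: bi_lipschitz_on_def field_simps)
  have "bounded (\<phi> ` U)"
  proof (cases "U = {}")
    case False
    then obtain a where a: "a \<in> U" by blast
    obtain e where e: "\<And>x. x \<in> U \<Longrightarrow> dist a x \<le> e"
      using U bounded_any_center[of U a] by auto
    have "dist (\<phi> a) (\<phi> x) \<le> C * e" if "x \<in> U" for x
      using hi[OF a that] e[OF that] C by (meson mult_left_mono order_trans zero_le_one)
    then show ?thesis unfolding bounded_def by blast
  qed auto
  then obtain R where R: "R > 0" "\<And>x. x \<in> U \<Longrightarrow> norm (\<phi> x) \<le> R"
    by (auto simp: bounded_pos)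
  define D where "D = 2 * (R * C * ?n + 1) + 1"
  have D: "D > 0" using R C by (auto simp: D_def intro!: add_pos_nonneg)
  have "covered_by U \<epsilon> (D ^ ?n * \<epsilon> powr (- real ?n))" if \<epsilon>: "0 < \<epsilon>" "\<epsilon> \<le> 1" for \<epsilon>
  proof -
    define \<eta> where "\<eta> = \<epsilon> / (C * ?n)"
    have \<eta>: "\<eta> > 0" using \<epsilon> C by (simp add: \<eta>_def)
    define k where "k = \<lceil>R / \<eta>\<rceil>"
    define T where "T = (PiE UNIV (\<lambda>_. {-k..k}) :: ('n \<Rightarrow> int) set)"
    define f where "f x i = \<lfloor>\<phi> x $ i / \<eta>\<rfloor>" for x i
    show ?thesis
    proof (rule covered_by_fibres)
      show "finite T" by (simp add: T_def finite_PiE)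
      show "f ` U \<subseteq> T"
      proof -
        have "- k \<le> f x i \<and> f x i \<le> k" if "x \<in> U" for x i
        proof -
          have "\<bar>\<phi> x $ i\<bar> \<le> R"
            using R(2)[OF that] component_le_norm_cart[of "\<phi> x" i] by linarith
          then have "- (R / \<eta>) \<le> \<phi> x $ i / \<eta>" "\<phi> x $ i / \<eta> \<le> R / \<eta>"
            using \<eta> by (auto simp: field_simps)
          then show ?thesis unfolding f_def k_def by linarith
        qed
        then show ?thesis by (auto simp: T_def)
      qed
      show "real (card T) \<le> D ^ ?n * \<epsilon> powr (- real ?n)"
      proof -
        have "0 < R / \<eta>" using R(1) \<eta> by simp
        then have k: "real_of_int k \<le> R / \<eta> + 1" "0 \<le> k"
          unfolding k_def by linarith+
        have "real (card T) = (2 * real_of_int k + 1) ^ ?n"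
          using k by (simp add: T_def card_PiE)
        also have "\<dots> \<le> (D / \<epsilon>) ^ ?n"
        proof (rule power_mono)
          have "2 * real_of_int k + 1 \<le> 2 * (R * C * ?n / \<epsilon> + 1) + 1"
            using k(1) by (simp add: \<eta>_def)
          also have "\<dots> \<le> 2 * (R * C * ?n / \<epsilon> + 1 / \<epsilon>) + 1 / \<epsilon>"
            using \<epsilon> by (intro add_mono mult_left_mono) auto
          also have "\<dots> = D / \<epsilon>" by (simp add: D_def add_divide_distrib)
          finally show "2 * real_of_int k + 1 \<le> D / \<epsilon>" .
        qed (use k in auto)
        also have "\<dots> = D ^ ?n * \<epsilon> powr (- real ?n)"
          using \<epsilon> by (simp add: power_divide powr_minus_divide powr_realpow)
        finally show ?thesis .
      qed
      fix x y assume xy: "x \<in> U" "y \<in> U" "f x = f y"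
      have "\<bar>(\<phi> x - \<phi> y) $ i\<bar> \<le> \<eta>" for i
      proof -
        have "\<lfloor>\<phi> x $ i / \<eta>\<rfloor> = \<lfloor>\<phi> y $ i / \<eta>\<rfloor>"
          using xy(3) by (metis f_def)
        then have "\<bar>\<phi> x $ i / \<eta> - \<phi> y $ i / \<eta>\<bar> \<le> 1" by linarith
        then show ?thesis
          using \<eta> by (simp flip: diff_divide_distrib add: abs_divide)
      qed
      then have "(\<Sum>i\<in>UNIV. \<bar>(\<phi> x - \<phi> y) $ i\<bar>) \<le> ?n * \<eta>"
        by (intro sum_bounded_above) auto
      then have "dist (\<phi> x) (\<phi> y) \<le> ?n * \<eta>"
        using norm_le_l1_cart[of "\<phi> x - \<phi> y"] by (simp add: dist_norm)
      then have "C * dist (\<phi> x) (\<phi> y) \<le> C * (?n * \<eta>)"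
        using C by (intro mult_left_mono) auto
      also have "\<dots> = \<epsilon>" using C by (simp add: \<eta>_def)
      finally show "dist x y \<le> \<epsilon>" using lo[OF xy(1,2)] by linarith
    qed
  qed
  then show ?thesis using D by (intro exI[of _ "D ^ ?n"]) auto
qed

lemma covered_by_Union:
  assumes "finite \<U>" "\<And>U. U \<in> \<U> \<Longrightarrow> covered_by U \<epsilon> (N U)"
  shows "covered_by (\<Union>\<U>) \<epsilon> (\<Sum>U\<in>\<U>. N U)"
proof -
  obtain S where S: "\<And>U. U \<in> \<U> \<Longrightarrow> S U \<subseteq> U \<and> finite (S U) \<and> real (card (S U)) \<le> N U \<and>
      U \<subseteq> (\<Union>x\<in>S U. cball x \<epsilon>)"
    using assms(2) unfolding covered_by_def by metis
  have "real (card (\<Union>U\<in>\<U>. S U)) \<le> (\<Sum>U\<in>\<U>. real (card (S U)))"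
    using card_UN_le[OF assms(1), of S] by (simp flip: of_nat_sum)
  also have "\<dots> \<le> (\<Sum>U\<in>\<U>. N U)"
    using S by (intro sum_mono) auto
  finally have "real (card (\<Union>U\<in>\<U>. S U)) \<le> (\<Sum>U\<in>\<U>. N U)" .
  moreover have "(\<Union>U\<in>\<U>. S U) \<subseteq> \<Union>\<U>" "finite (\<Union>U\<in>\<U>. S U)"
    using S assms(1) by auto
  moreover have "\<Union>\<U> \<subseteq> (\<Union>x\<in>(\<Union>U\<in>\<U>. S U). cball x \<epsilon>)"
  proof
    fix y assume "y \<in> \<Union>\<U>"
    then obtain U where U: "U \<in> \<U>" "y \<in> U" by blast
    then have "y \<in> (\<Union>x\<in>S U. cball x \<epsilon>)" using S[OF U(1)] by blast
    then show "y \<in> (\<Union>x\<in>(\<Union>U\<in>\<U>. S U). cball x \<epsilon>)" using U(1) by blast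
  qed
  ultimately show ?thesis
    unfolding covered_by_def by blast
qed

text \<open>Finitely many charts give a bound \<open>c * \<epsilon> powr -n\<close>, and the constant is absorbed by \<open>t > n\<close>.\<close>

lemma covered_by_manifold:
  fixes X :: "'a::metric_space set"
  assumes X: "compact X" and M: "metric_manifold TYPE('n::finite) X" and t: "real CARD('n) < t"
  shows "\<forall>\<^sub>F \<epsilon> in at_right 0. covered_by X \<epsilon> (\<epsilon> powr (-t))"
proof -
  define \<C> where "\<C> = {U. openin (top_of_set X) U \<and>
      (\<exists>\<phi> :: 'a \<Rightarrow> real^'n. bi_lipschitz_on U \<phi>)}"
  have "X \<subseteq> \<Union>\<C>"
    using M by (fastforce simp: metric_manifold_def \<C>_def)
  moreover have "\<forall>U\<in>\<C>. openin (top_of_set X) U" by (simp add: \<C>_def)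
  ultimately obtain \<D> where \<D>: "\<D> \<subseteq> \<C>" "finite \<D>" "X \<subseteq> \<Union>\<D>"
    using X unfolding compact_eq_openin_cover by meson
  have UX: "U \<subseteq> X" if "U \<in> \<D>" for U
    using that \<D>(1) openin_imp_subset[of euclidean X U] by (auto simp: \<C>_def)
  have X_eq: "X = \<Union>\<D>" using \<D>(3) UX by blast
  have "\<forall>U\<in>\<D>. \<exists>c>0. \<forall>\<epsilon>. 0 < \<epsilon> \<and> \<epsilon> \<le> 1 \<longrightarrow> covered_by U \<epsilon> (c * \<epsilon> powr (- real CARD('n)))"
  proof
    fix U assume U: "U \<in> \<D>"
    then obtain \<phi> :: "'a \<Rightarrow> real^'n" where "bi_lipschitz_on U \<phi>"
      using \<D>(1) by (auto simp: \<C>_def)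
    then show "\<exists>c>0. \<forall>\<epsilon>. 0 < \<epsilon> \<and> \<epsilon> \<le> 1 \<longrightarrow> covered_by U \<epsilon> (c * \<epsilon> powr (- real CARD('n)))"
      using bounded_subset[OF compact_imp_bounded[OF X] UX[OF U]]
      by (intro covered_by_bi_lipschitz_chart)
  qed
  then obtain c where c: "\<And>U. U \<in> \<D> \<Longrightarrow> c U > 0"
      "\<And>U \<epsilon>. U \<in> \<D> \<Longrightarrow> 0 < \<epsilon> \<Longrightarrow> \<epsilon> \<le> 1 \<Longrightarrow> covered_by U \<epsilon> (c U * \<epsilon> powr (- real CARD('n)))"
    by metis
  define c' where "c' = 1 + (\<Sum>U\<in>\<D>. c U)"
  have c': "c' > 0"
    using sum_nonneg[of \<D> c, OF less_imp_le[OF c(1)]] by (simp add: c'_def)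
  have "\<forall>\<^sub>F \<epsilon> in at_right 0. c' * \<epsilon> powr (- real CARD('n)) \<le> \<epsilon> powr (-t)"
    using c' t by real_asymp
  moreover have "\<forall>\<^sub>F \<epsilon>::real in at_right 0. 0 < \<epsilon> \<and> \<epsilon> \<le> 1"
    by (auto simp: eventually_at_right_field intro!: exI[of _ 1])
  ultimately show ?thesis
  proof eventually_elim
    case (elim \<epsilon>)
    have "covered_by X \<epsilon> (\<Sum>U\<in>\<D>. c U * \<epsilon> powr (- real CARD('n)))"
      unfolding X_eq using elim by (intro covered_by_Union \<D>(2) c(2)) auto
    moreover have "(\<Sum>U\<in>\<D>. c U * \<epsilon> powr (- real CARD('n))) \<le> c' * \<epsilon> powr (- real CARD('n))"
      by (simp add: c'_def sum_distrib_right distrib_right)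
    ultimately show ?case
      using elim(1) by (meson covered_by_mono order_trans)
  qed
qed

lemma covered_by_Minkowski:
  fixes X :: "'a::metric_space set"
  assumes X: "compact X" and d: "upper_Minkowski_dim X < ereal t" and t: "0 < t"
  shows "\<forall>\<^sub>F \<epsilon> in at_right 0. covered_by X \<epsilon> (\<epsilon> powr (-t))"
proof -
  have "\<forall>\<^sub>F \<epsilon> in at_right 0. ereal (ln (real (covering_number X \<epsilon>)) / ln (1 / \<epsilon>)) < ereal t"
    using d unfolding upper_Minkowski_dim_def by (rule Limsup_lessD)
  moreover have "\<forall>\<^sub>F \<epsilon>::real in at_right 0. 0 < \<epsilon> \<and> \<epsilon> < 1"
    by (auto simp: eventually_at_right_field intro!: exI[of _ 1])
  ultimately show ?thesis
  proof eventually_elim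
    case (elim \<epsilon>)
    let ?N = "covering_number X \<epsilon>"
    let ?P = "\<lambda>n. \<exists>S. S \<subseteq> X \<and> finite S \<and> card S = n \<and> X \<subseteq> (\<Union>x\<in>S. ball x \<epsilon>)"
    have "\<exists>S. S \<subseteq> X \<and> finite S \<and> X \<subseteq> (\<Union>x\<in>S. ball x \<epsilon>)"
    proof -
      have "X \<subseteq> (\<Union>x\<in>X. ball x \<epsilon>)" using elim by auto
      then obtain S where "S \<subseteq> X" "finite S" "X \<subseteq> (\<Union>x\<in>S. ball x \<epsilon>)"
        using compactE_image[OF X, of X "\<lambda>x. ball x \<epsilon>"] by auto
      then show ?thesis by blast
    qed
    then have "\<exists>n. ?P n" by blast
    then have "?P ?N" unfolding covering_number_def by (rule LeastI_ex)
    then obtain S where S: "S \<subseteq> X" "finite S" "card S = ?N" "X \<subseteq> (\<Union>x\<in>S. ball x \<epsilon>)"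
      by blast
    have "real ?N \<le> \<epsilon> powr (-t)"
    proof (cases "?N = 0")
      case False
      have "ln (real ?N) / ln (1 / \<epsilon>) < t" using elim by simp
      moreover have "ln (1 / \<epsilon>) > 0" using elim by simp
      ultimately have "ln (real ?N) < t * ln (1 / \<epsilon>)" by (simp add: pos_divide_less_eq)
      also have "\<dots> = ln (\<epsilon> powr (-t))" using elim by (simp add: ln_powr ln_div)
      finally have "ln (real ?N) < ln (\<epsilon> powr (-t))" .
      then have "real ?N < \<epsilon> powr (-t)"
        using False elim by (subst (asm) ln_less_cancel_iff) auto
      then show ?thesis by simp
    qed simp
    moreover have "X \<subseteq> (\<Union>x\<in>S. cball x \<epsilon>)" 
      by (rule order_trans[OF S(4)]) (intro UN_mono subset_refl ball_subset_cball)
    ultimately show ?case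
      unfolding covered_by_def using S(1,2) by (intro exI[of _ S]) (simp add: S(3))
  qed
qed

section \<open>The upper bound for the hyperspace\<close>

text \<open>The cover consists of the closed Hausdorff balls around the subsets of \<open>S\<close>: a closed set \<open>K\<close> lies
in the ball around the set of all centres within \<open>\<epsilon>\<close> of \<open>K\<close>.\<close>

lemma hyperspace_finite_closed_cover:
  fixes X :: "'a::metric_space set"
  assumes X: "compact X" and S: "S \<subseteq> X" "finite S" "X \<subseteq> (\<Union>x\<in>S. cball x \<epsilon>)"
    and \<epsilon>: "0 \<le> \<epsilon>"
  defines "m \<equiv> hyperspace X"
  obtains F where "finite F" "card F \<le> 2 ^ card S" "closed_subsets X \<subseteq> \<Union>F"
    and "\<And>E. E \<in> F \<Longrightarrow> closedin (mtopology_of m) E \<and>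
           Metric_space.mbounded (mspace m) (mdist m) E \<and> mdiam m E \<le> 2 * \<epsilon>"
proof
  interpret H: Metric_space "closed_subsets X" hausdorff_dist
    by (rule Metric_space_hyperspace[OF X])
  let ?F = "(\<lambda>A. H.mcball A \<epsilon>) ` Pow S"
  show "finite ?F" using S by simp
  show "card ?F \<le> 2 ^ card S"
    using card_image_le[of "Pow S"] S by (simp add: card_Pow)
  show "closed_subsets X \<subseteq> \<Union>?F"
  proof
    fix K assume K: "K \<in> closed_subsets X"
    note cK = closed_subsets_compact[OF X K]
    have KX: "K \<subseteq> X" using K by (auto simp: closed_subsets_def closedin_def)
    define A where "A = {x\<in>S. \<exists>y\<in>K. dist x y \<le> \<epsilon>}"
    have near: "\<exists>x\<in>A. dist x y \<le> \<epsilon>" if "y \<in> K" for y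
      using that KX S(3) by (fastforce simp: A_def)
    have "A \<noteq> {}" using near cK by blast
    have AS: "finite A" "A \<subseteq> S" using S(2) by (auto simp: A_def)
    have Ac: "A \<in> closed_subsets X"
      using AS S \<open>A \<noteq> {}\<close>
      by (auto simp: closed_subsets_def intro!: closed_subset finite_imp_closed)
    have "hausdorff_dist A K \<le> \<epsilon>"
    proof (rule hausdorff_dist_le)
      show "infdist x K \<le> \<epsilon>" if "x \<in> A" for x
        using that by (auto simp: A_def intro: order_trans[OF infdist_le])
      show "infdist y A \<le> \<epsilon>" if "y \<in> K" for y
        using near[OF that] by (auto simp: dist_commute intro: order_trans[OF infdist_le])
    qed (use AS \<open>A \<noteq> {}\<close> cK compact_imp_bounded finite_imp_bounded in auto)
    then have "K \<in> H.mcball A \<epsilon>" using Ac K by (simp add: H.in_mcball)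
    then show "K \<in> \<Union>?F" using AS by blast
  qed
  fix E assume "E \<in> ?F"
  then obtain A where A: "E = H.mcball A \<epsilon>" by blast
  have m: "mspace m = closed_subsets X" "mdist m = hausdorff_dist"
    using mspace_hyperspace[OF X] mdist_hyperspace[OF X] by (auto simp: m_def)
  have "hausdorff_dist K L \<le> 2 * \<epsilon>" if "K \<in> E" "L \<in> E" for K L
    using that H.triangle[of K A L] by (auto simp: A H.in_mcball H.commute[of K A])
  then have "mdiam m E \<le> 2 * \<epsilon>"
    using \<epsilon> by (intro mdiam_le) (auto simp: m)
  then show "closedin (mtopology_of m) E \<and>
      Metric_space.mbounded (mspace m) (mdist m) E \<and> mdiam m E \<le> 2 * \<epsilon>"
    by (simp add: A m mtopology_of_def H.mbounded_mcball)
qed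

text \<open>The logarithm of the number of covering sets is at most of order \<open>\<epsilon> powr -t\<close>, whereas the gauge decays like
\<open>exp (- (1 / (2 * \<epsilon>)) powr s)\<close>, so for \<open>t < s\<close> the gauge wins.\<close>

lemma Lambda_hyperspace_eq_0:
  fixes X :: "'a::metric_space set"
  assumes X: "compact X" and t: "0 < t" "t < s"
    and cov: "\<forall>\<^sub>F \<epsilon> in at_right 0. covered_by X \<epsilon> (\<epsilon> powr (-t))"
  shows "Lambda (hyperspace X) (pow_exp s) (closed_subsets X) = 0"
proof -
  let ?L = "Lambda_pre (hyperspace X) (pow_exp s) (closed_subsets X)"
  let ?b = "\<lambda>\<epsilon>. 2 powr (\<epsilon> powr (-t)) * exp (- ((1 / (2 * \<epsilon>)) powr s))"
  have lim: "(?b \<longlongrightarrow> 0) (at_right 0)"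
    using t by real_asymp
  have "?L \<delta> \<le> 0" if \<delta>: "0 < \<delta>" for \<delta>
  proof (rule tendsto_lowerbound)
    show "((\<lambda>\<epsilon>. ennreal (?b \<epsilon>)) \<longlongrightarrow> 0) (at_right 0)"
      using tendsto_ennrealI[OF lim] by simp
    have "\<forall>\<^sub>F \<epsilon> in at_right 0. 0 < \<epsilon> \<and> \<epsilon> < \<delta> / 2"
      using \<delta> by (auto simp: eventually_at_right_field intro!: exI[of _ "\<delta> / 2"])
    with cov show "\<forall>\<^sub>F \<epsilon> in at_right 0. ?L \<delta> \<le> ennreal (?b \<epsilon>)"
    proof eventually_elim
      case (elim \<epsilon>)
      then obtain S where S: "S \<subseteq> X" "finite S" "real (card S) \<le> \<epsilon> powr (-t)"
          "X \<subseteq> (\<Union>x\<in>S. cball x \<epsilon>)"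
        by (auto simp: covered_by_def)
      obtain F where F: "finite F" "card F \<le> 2 ^ card S" "closed_subsets X \<subseteq> \<Union>F"
        and E: "\<And>E. E \<in> F \<Longrightarrow> closedin (mtopology_of (hyperspace X)) E \<and>
           Metric_space.mbounded (mspace (hyperspace X)) (mdist (hyperspace X)) E \<and>
           mdiam (hyperspace X) E \<le> 2 * \<epsilon>"
        by (rule hyperspace_finite_closed_cover[OF X S(1,2,4) less_imp_le]) (use elim in simp, rule that)
      have pe: "pow_exp s (mdiam (hyperspace X) D) \<le> pow_exp s (2 * \<epsilon>)" if "D \<in> F" for D
        using E[OF that] t by (intro pow_exp_mono) auto
      have "?L \<delta> \<le> ennreal (real (card F) * pow_exp s (2 * \<epsilon>))"
      proof (rule Lambda_pre_finite_cover[OF F(1,3)])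
        fix D assume "D \<in> F"
        then show "closedin (mtopology_of (hyperspace X)) D \<and>
            Metric_space.mbounded (mspace (hyperspace X)) (mdist (hyperspace X)) D \<and>
            mdiam (hyperspace X) D \<le> \<delta> \<and>
            pow_exp s (mdiam (hyperspace X) D) \<le> pow_exp s (2 * \<epsilon>)"
          using E[of D] pe[of D] elim by linarith
      qed (use \<delta> in \<open>auto simp: pow_exp_def\<close>)
      also have "\<dots> \<le> ennreal (?b \<epsilon>)"
      proof (intro ennreal_leI)
        have "real (card F) \<le> real (2 ^ card S)"
          using F(2) by (rule of_nat_mono)
        also have "\<dots> = 2 powr (real (card S))"
          by (simp add: powr_realpow)
        also have "\<dots> \<le> 2 powr (\<epsilon> powr (-t))"
          using S(3) by simp
        finally show "real (card F) * pow_exp s (2 * \<epsilon>) \<le> ?b \<epsilon>"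
          using elim by (simp add: pow_exp_def)
      qed
      finally show ?case .
    qed
  qed simp
  then show ?thesis
    by (simp add: Lambda_eq_SUP)
qed

section \<open>Independent fair coins\<close>

definition fair_coins :: "('i \<Rightarrow> bool) measure" where
  "fair_coins = PiM UNIV (\<lambda>_. measure_pmf (bernoulli_pmf (1/2)))"

lemma prob_space_fair_coins: "prob_space (fair_coins :: ('i \<Rightarrow> bool) measure)"
  unfolding fair_coins_def by (intro prob_space_PiM measure_pmf.prob_space_axioms)

lemma space_fair_coins [simp]: "space fair_coins = UNIV"
  by (simp add: fair_coins_def space_PiM)

lemma
  fixes a :: "'i \<Rightarrow> bool"
  assumes J: "finite J"
  shows fair_coins_cylinder_sets: "{\<omega>. \<forall>i\<in>J. \<omega> i = a i} \<in> sets fair_coins"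
    and emeasure_fair_coins_cylinder:
      "emeasure fair_coins {\<omega>. \<forall>i\<in>J. \<omega> i = a i} = ennreal ((1/2) ^ card J)"
proof -
  let ?M = "\<lambda>_::'i. measure_pmf (bernoulli_pmf (1/2))"
  interpret product_prob_space ?M UNIV
    by unfold_locales
  have half: "emeasure (measure_pmf (bernoulli_pmf (1/2))) {b} = ennreal (1/2)" for b
    by (cases b) (simp_all add: emeasure_pmf_single)
  have eq: "{\<omega>. \<forall>i\<in>J. \<omega> i = a i} = prod_emb UNIV ?M J (Pi\<^sub>E J (\<lambda>i. {a i}))"
    by (rule set_eqI) (simp add: prod_emb_iff PiE_iff)
  show "{\<omega>. \<forall>i\<in>J. \<omega> i = a i} \<in> sets fair_coins"
    unfolding eq fair_coins_def using J by (intro sets_PiM_I) auto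
  have "emeasure fair_coins {\<omega>. \<forall>i\<in>J. \<omega> i = a i} = (\<Prod>i\<in>J. emeasure (?M i) {a i})"
    unfolding eq fair_coins_def using J by (intro emeasure_PiM_emb) auto
  also have "\<dots> = (\<Prod>i\<in>J. ennreal (1/2))"
    unfolding half ..
  also have "\<dots> = ennreal (1/2) ^ card J"
    by (rule prod_constant)
  also have "\<dots> = ennreal ((1/2) ^ card J)"
    by (rule ennreal_power) simp
  finally show "emeasure fair_coins {\<omega>. \<forall>i\<in>J. \<omega> i = a i} = ennreal ((1/2) ^ card J)" .
qed

section \<open>Separated grids accumulating at a corner of the cube\<close>

lemma compact_insert_limit:
  fixes a :: "'a::metric_space"
  assumes "\<And>e. 0 < e \<Longrightarrow> finite {x\<in>S. e \<le> dist x a}"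
  shows "compact (insert a S)"
  unfolding compact_eq_Heine_Borel
proof (intro allI impI, elim conjE)
  fix \<C> assume \<C>: "\<forall>U\<in>\<C>. open U" "insert a S \<subseteq> \<Union>\<C>"
  then obtain U where U: "U \<in> \<C>" "a \<in> U" by blast
  then obtain e where e: "0 < e" "ball a e \<subseteq> U"
    using \<C>(1) open_contains_ball by blast
  let ?F = "{x\<in>S. e \<le> dist x a}"
  have "compact ?F" using assms[OF e(1)] by (rule finite_imp_compact)
  then obtain \<D> where \<D>: "\<D> \<subseteq> \<C>" "finite \<D>" "?F \<subseteq> \<Union>\<D>"
    using \<C> compactE[of ?F \<C>] by (metis (no_types, lifting) insertCI mem_Collect_eq subset_eq)
  have "insert a S \<subseteq> \<Union>(insert U \<D>)"
  proof
    fix x assume "x \<in> insert a S"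
    then have "x \<in> ball a e \<or> x \<in> ?F" using e(1) by (auto simp: dist_commute)
    then show "x \<in> \<Union>(insert U \<D>)" using e(2) \<D>(3) by blast
  qed
  then show "\<exists>\<C>'\<subseteq>\<C>. finite \<C>' \<and> insert a S \<subseteq> \<Union>\<C>'"
    using \<D> U by (intro exI[of _ "insert U \<D>"]) auto
qed

text \<open>The coordinates of the points are \<open>2 powr -(j+1) * (1 + k / B ^ j)\<close> with \<open>1 \<le> k \<le> B ^ j\<close>. The value
\<open>k = 0\<close> is left out so that a point keeps its distance not only from its neighbours in the grid but
also from the smaller grids, which lie in the box with upper corner \<open>2 powr -(j+1)\<close>.\<close>
definition grid :: "nat \<Rightarrow> nat \<Rightarrow> (real^'n) set" where
  "grid B j = (\<lambda>k. \<chi> i. (1 + real (k i) / real B ^ j) / 2 ^ Suc j) ` (UNIV \<rightarrow>\<^sub>E {1..B ^ j})"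

definition grid_sep :: "nat \<Rightarrow> nat \<Rightarrow> real" where
  "grid_sep B j = 1 / (2 * (2 * real B) ^ j)"

context
  fixes B :: nat
  assumes B: "2 \<le> B"
begin

lemma grid_sep_pos: "0 < grid_sep B j"
  using B by (simp add: grid_sep_def)

lemma grid_sep_antimono: "i \<le> j \<Longrightarrow> grid_sep B j \<le> grid_sep B i"
proof -
  assume "i \<le> j"
  then have "(2 * real B) ^ i \<le> (2 * real B) ^ j"
    using B by (intro power_increasing) auto
  then show ?thesis
    using B unfolding grid_sep_def by (intro divide_left_mono) auto
qed

lemma grid_sep_eq: "grid_sep B j = 1 / real B ^ j / 2 ^ Suc j"
  by (simp add: grid_sep_def power_mult_distrib)

lemma grid_component:
  fixes p :: "real^'n"
  assumes "p \<in> grid B j"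
  shows "1 / 2 ^ Suc j + grid_sep B j \<le> p $ c" "p $ c \<le> 1 / 2 ^ j"
proof -
  obtain k where k: "k \<in> UNIV \<rightarrow>\<^sub>E {1..B ^ j}"
    and p: "p $ c = (1 + real (k c) / real B ^ j) / 2 ^ Suc j"
    using assms by (auto simp: grid_def)
  have "k c \<in> {1..B ^ j}" using k by auto
  then have "real 1 \<le> real (k c)" "real (k c) \<le> real (B ^ j)"
    unfolding of_nat_le_iff by auto
  then have *: "1 / real B ^ j \<le> real (k c) / real B ^ j" "real (k c) / real B ^ j \<le> 1"
    using B by (auto simp: divide_right_mono)
  show "1 / 2 ^ Suc j + grid_sep B j \<le> p $ c"
    using divide_right_mono[OF *(1), of "2 ^ Suc j"]
    unfolding p grid_sep_eq add_divide_distrib by simp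
  show "p $ c \<le> 1 / 2 ^ j"
    using divide_right_mono[OF *(2), of "2 ^ Suc j"]
    unfolding p add_divide_distrib by simp
qed

lemma finite_grid: "finite (grid B j :: (real^'n) set)"
  unfolding grid_def by (intro finite_imageI finite_PiE) auto

lemma card_grid: "card (grid B j :: (real^'n) set) = (B ^ j) ^ CARD('n)"
proof -
  let ?h = "\<lambda>k. (\<chi> i. (1 + real (k i) / real B ^ j) / 2 ^ Suc j) :: real^'n"
  have "inj ?h"
  proof (rule injI, rule ext)
    fix k l i assume "?h k = ?h l"
    then have "?h k $ i = ?h l $ i" by simp
    then show "k i = l i" using B by simp
  qed
  then have "card (grid B j :: (real^'n) set) = card (UNIV \<rightarrow>\<^sub>E {1..B ^ j} :: ('n \<Rightarrow> nat) set)"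
    unfolding grid_def by (intro card_image) (auto intro: inj_on_subset)
  then show ?thesis by (simp add: card_PiE)
qed

lemma grid_separated_same:
  fixes p q :: "real^'n"
  assumes "p \<in> grid B j" "q \<in> grid B j" "p \<noteq> q"
  shows "grid_sep B j \<le> dist p q"
proof -
  obtain k l where "p = (\<chi> i. (1 + real (k i) / real B ^ j) / 2 ^ Suc j)"
    and "q = (\<chi> i. (1 + real (l i) / real B ^ j) / 2 ^ Suc j)"
    using assms(1,2) unfolding grid_def by blast
  then have p: "p $ i = (1 + real (k i) / real B ^ j) / 2 ^ Suc j"
    and q: "q $ i = (1 + real (l i) / real B ^ j) / 2 ^ Suc j" for i
    by auto
  obtain c where c: "p $ c \<noteq> q $ c" using assms(3) by (auto simp: vec_eq_iff)
  then have "k c \<noteq> l c" by (auto simp: p q)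
  then have "1 \<le> \<bar>real (k c) - real (l c)\<bar>" by linarith
  then have "1 / real B ^ j / 2 ^ Suc j \<le> \<bar>real (k c) - real (l c)\<bar> / real B ^ j / 2 ^ Suc j"
    by (intro divide_right_mono) auto
  also have "\<dots> = \<bar>(real (k c) - real (l c)) / real B ^ j / 2 ^ Suc j\<bar>"
    by (simp add: abs_divide abs_mult)
  also have "(real (k c) - real (l c)) / real B ^ j / 2 ^ Suc j = p $ c - q $ c"
    by (simp add: p q add_divide_distrib diff_divide_distrib)
  also have "\<bar>p $ c - q $ c\<bar> \<le> dist p q"
    using dist_vec_nth_le[of p c q] by (simp add: dist_real_def)
  finally show ?thesis unfolding grid_sep_eq .
qed

text \<open>Boxes of different levels do not overlap in any coordinate, and every coordinate of a point of
level \<open>i\<close> exceeds the lower end of its box by at least \<open>grid_sep B i\<close>.\<close>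

lemma grid_separated_less:
  fixes p q :: "real^'n"
  assumes "p \<in> grid B i" "q \<in> grid B j" "i < j"
  shows "grid_sep B i \<le> dist p q"
proof -
  fix c :: 'n
  have "(1::real) / 2 ^ j \<le> 1 / 2 ^ Suc i"
    using assms(3) by (intro divide_left_mono power_increasing) auto
  then have "grid_sep B i \<le> p $ c - q $ c"
    using grid_component(1)[OF assms(1), of c] grid_component(2)[OF assms(2), of c] by linarith
  also have "\<dots> \<le> dist p q"
    using dist_vec_nth_le[of p c q] by (simp add: dist_real_def)
  finally show ?thesis .
qed

lemma grid_separated:
  fixes p q :: "real^'n"
  assumes "p \<in> grid B j" "q \<in> insert 0 (\<Union>i. grid B i)" "p \<noteq> q"
  shows "grid_sep B j \<le> dist p q"
proof (cases "q = 0")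
  case True
  fix c :: 'n
  have "(0::real) \<le> 1 / 2 ^ Suc j" "q $ c = 0" using True by auto
  then have "grid_sep B j \<le> p $ c - q $ c"
    using grid_component(1)[OF assms(1), of c] by linarith
  also have "\<dots> \<le> dist p q"
    using dist_vec_nth_le[of p c q] by (simp add: dist_real_def)
  finally show ?thesis .
next
  case False
  then obtain i where q: "q \<in> grid B i" using assms(2) by blast
  consider "i < j" | "i = j" | "j < i" by linarith
  then show ?thesis
  proof cases
    case 1
    then show ?thesis
      using grid_separated_less[OF q assms(1)] grid_sep_antimono[of i j] by (simp add: dist_commute)
  next
    case 2
    then show ?thesis using grid_separated_same assms q by blast
  next
    case 3
    then show ?thesis using grid_separated_less[OF assms(1) q] by simp
  qed
qed

lemma grid_subset_cube: "insert 0 (\<Union>j. grid B j) \<subseteq> (cbox 0 1 :: (real^'n) set)"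
proof -
  have "0 \<le> p $ c \<and> p $ c \<le> 1" if "p \<in> grid B j" for p :: "real^'n" and j c
  proof -
    have "(0::real) < 1 / 2 ^ Suc j" "(1::real) / 2 ^ j \<le> 1" by (auto simp: one_le_power)
    then show ?thesis
      using grid_component[OF that, of c] grid_sep_pos[of j] by linarith
  qed
  then show ?thesis by (auto simp: mem_box_cart)
qed

lemma compact_grid_subset:
  fixes Q :: "(real^'n) set"
  assumes "Q \<subseteq> (\<Union>j. grid B j)"
  shows "compact (insert 0 Q)"
proof (rule compact_insert_limit)
  fix e :: real assume e: "0 < e"
  have "(\<lambda>j. real CARD('n) * (1/2) ^ j) \<longlonglongrightarrow> 0"
    by real_asymp
  then have "\<forall>\<^sub>F j in sequentially. real CARD('n) * (1/2) ^ j < e"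
    using e by (rule order_tendstoD)
  then obtain J where J: "\<And>j. J \<le> j \<Longrightarrow> real CARD('n) * (1/2) ^ j < e"
    by (auto simp: eventually_sequentially)
  have "{x\<in>Q. e \<le> dist x 0} \<subseteq> (\<Union>j<J. grid B j)"
  proof
    fix x assume x: "x \<in> {x\<in>Q. e \<le> dist x 0}"
    then obtain j where j: "x \<in> grid B j" using assms by blast
    have "\<bar>x $ c\<bar> \<le> (1/2) ^ j" for c
    proof -
      have "0 \<le> x $ c"
        using x assms grid_subset_cube by (force simp: mem_box_cart)
      then show ?thesis using grid_component(2)[OF j, of c] by (simp add: power_one_over)
    qed
    then have "(\<Sum>c\<in>UNIV. \<bar>x $ c\<bar>) \<le> CARD('n) * (1/2) ^ j"
      by (intro sum_bounded_above) auto
    then have "e \<le> CARD('n) * (1/2) ^ j"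
      using x norm_le_l1_cart[of x] by simp
    then have "j < J" using J[of j] by (meson linorder_not_le)
    then show "x \<in> (\<Union>j<J. grid B j)" using j by blast
  qed
  then show "finite {x\<in>Q. e \<le> dist x 0}"
    by (rule finite_subset) (simp add: finite_grid)
qed

end

section \<open>The lower bound for the hyperspace\<close>

lemma hausdorff_dist_separated:
  assumes "a \<in> K" "L \<noteq> {}" "bounded K" "bounded L" "\<And>b. b \<in> L \<Longrightarrow> r \<le> dist a b"
  shows "r \<le> hausdorff_dist K L"
proof -
  have "r \<le> infdist a L"
    using assms(2,5) by (auto simp: infdist_def intro!: cINF_greatest)
  also have "\<dots> \<le> hausdorff_dist K L"
    using assms by (intro infdist_le_hausdorff_dist)
  finally show ?thesis .
qed

text \<open>With ratio \<open>B\<close>, the \<open>j\<close>-th grid carries \<open>(B ^ j) ^ n\<close> coins while the next separation is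
\<open>1 / (2 * (2 * B) ^ Suc j)\<close>. The quotient of the two sides is a constant times
\<open>((2 * B) powr s / B powr n) ^ j\<close>, and its base drops below \<open>1\<close> for large \<open>B\<close> since \<open>s < n\<close>.\<close>

lemma ex_grid_ratio:
  assumes s: "s < real n" and C: "0 < C"
  obtains B J where "2 \<le> B"
    and "\<And>j. J \<le> j \<Longrightarrow> (C / grid_sep B (Suc j)) powr s \<le> ln 2 * real ((B ^ j) ^ n)"
proof -
  have "\<forall>\<^sub>F B::nat in sequentially. (2 * real B) powr s < real B powr n \<and> 2 \<le> B"
    using s by (intro eventually_conj eventually_ge_at_top) real_asymp
  then obtain B :: nat where B: "2 \<le> B" and Bs: "(2 * real B) powr s < real B powr n"
    by (auto simp: eventually_sequentially)
  have "\<forall>\<^sub>F j in sequentially. (C / grid_sep B (Suc j)) powr s \<le> ln 2 * real ((B ^ j) ^ n)"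
  proof -
    define q where "q = (2 * real B) powr s / real B powr n"
    have q: "0 < q" "q < 1" using Bs B by (auto simp: q_def)
    define D where "D = (4 * C * real B) powr s / ln 2"
    have D: "0 < D" using C B by (simp add: D_def)
    have "\<forall>\<^sub>F j in sequentially. D * q ^ j \<le> 1"
      using q D by real_asymp
    then show ?thesis
    proof eventually_elim
      case (elim j)
      have "C / grid_sep B (Suc j) = (4 * C * real B) * (2 * real B) ^ j"
        using C by (simp add: grid_sep_def)
      then have "(C / grid_sep B (Suc j)) powr s = (4 * C * real B) powr s * ((2 * real B) powr s) ^ j"
        using C B by (simp add: powr_mult powr_powr mult.commute flip: powr_realpow)
      also have "\<dots> = ln 2 * (D * q ^ j) * (real B powr n) ^ j"
        using B by (simp add: D_def q_def power_divide)
      also have "\<dots> \<le> ln 2 * 1 * (real B powr n) ^ j"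
        using elim by (intro mult_right_mono mult_left_mono) auto
      also have "\<dots> = ln 2 * real ((B ^ j) ^ n)"
        using B by (simp add: powr_realpow mult.commute flip: power_mult)
      finally show ?case .
    qed
  qed
  then obtain J where "\<And>j. J \<le> j \<Longrightarrow> (C / grid_sep B (Suc j)) powr s \<le> ln 2 * real ((B ^ j) ^ n)"
    by (auto simp: eventually_sequentially)
  with B show thesis by (rule that)
qed

text \<open>The random closed set is \<open>K \<omega>\<close>, the image of the corner \<open>0\<close> and of those grid points whose coin
shows \<open>True\<close>.\<close>

lemma Lambda_hyperspace_pos:
  fixes X :: "'a::metric_space set" and g :: "real^'n \<Rightarrow> 'a"
  assumes X: "compact X" and gX: "g ` cbox 0 1 \<subseteq> X" and g: "bi_lipschitz_on (cbox 0 1) g"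
    and s: "0 < s" "s < real CARD('n)"
  shows "0 < Lambda (hyperspace X) (pow_exp s) (closed_subsets X)"
proof -
  let ?n = "CARD('n)" and ?m = "hyperspace X"
  obtain C where C: "C \<ge> 1"
    and lo: "\<And>x y. x \<in> cbox 0 1 \<Longrightarrow> y \<in> cbox 0 1 \<Longrightarrow> dist x y / C \<le> dist (g x) (g y)"
    and hi: "\<And>x y. x \<in> cbox 0 1 \<Longrightarrow> y \<in> cbox 0 1 \<Longrightarrow> dist (g x) (g y) \<le> C * dist x y"
    using g by (auto simp: bi_lipschitz_on_def divide_inverse mult.commute)
  have cont: "continuous_on (cbox 0 1) g"
    using hi C by (intro lipschitz_on_continuous_on[of C] lipschitz_onI) auto

  obtain B J where B: "2 \<le> B"
    and J: "\<And>j. J \<le> j \<Longrightarrow> (C / grid_sep B (Suc j)) powr s \<le> ln 2 * real ((B ^ j) ^ ?n)"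
    using ex_grid_ratio[of s ?n C] s(2) C by auto

  define r where "r j = grid_sep B j / C" for j
  have r_pos: "0 < r j" for j using grid_sep_pos[OF B] C by (simp add: r_def)
  have r_mono: "r j \<le> r i" if "i \<le> j" for i j
    using grid_sep_antimono[OF B that] C by (simp add: r_def divide_right_mono)
  have r_0: "r \<longlonglongrightarrow> 0"
  proof -
    have "(\<lambda>j. 1 / (2 * (2 * real B) ^ j) / C) \<longlonglongrightarrow> 0"
      using B C by real_asymp
    then show ?thesis by (simp only: r_def[abs_def] grid_sep_def)
  qed

  define P :: "(real^'n) set" where "P = (\<Union>j. grid B j)"
  define K where "K \<omega> = g ` insert 0 {p \<in> P. \<omega> p}" for \<omega> :: "real^'n \<Rightarrow> bool"
  have cube: "insert 0 P \<subseteq> cbox 0 1"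
    unfolding P_def by (rule grid_subset_cube[OF B])
  have cK: "compact (K \<omega>)" for \<omega>
    unfolding K_def
  proof (rule compact_continuous_image)
    show "compact (insert 0 {p \<in> P. \<omega> p})"
      by (rule compact_grid_subset[OF B]) (auto simp: P_def)
    show "continuous_on (insert 0 {p \<in> P. \<omega> p}) g"
      by (rule continuous_on_subset[OF cont]) (use cube in auto)
  qed
  have KX: "K \<omega> \<in> closed_subsets X" for \<omega>
  proof -
    have "K \<omega> \<subseteq> X" using gX cube by (auto simp: K_def)
    then show ?thesis
      using compact_imp_closed[OF cK[of \<omega>]] unfolding closed_subsets_def
      by (auto simp: K_def intro!: closed_subset)
  qed
  have sep1: "r j \<le> hausdorff_dist (K \<omega>) (K \<omega>')"
    if p: "p \<in> grid B j" "\<omega> p" "\<not> \<omega>' p" for j p \<omega> \<omega>'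
  proof (rule hausdorff_dist_separated)
    have pP: "p \<in> P" using p(1) by (auto simp: P_def)
    then show "g p \<in> K \<omega>" using p(2) by (auto simp: K_def)
    fix b assume "b \<in> K \<omega>'"
    then obtain q where q: "b = g q" "q \<in> insert 0 {p \<in> P. \<omega>' p}"
      unfolding K_def by blast
    have "p \<noteq> 0"
      using grid_component(1)[OF B p(1)] grid_sep_pos[OF B, of j]
      by (metis add_nonneg_pos divide_nonneg_nonneg not_less zero_index zero_le_one
          zero_le_numeral zero_le_power)
    then have "p \<noteq> q" using q(2) p(3) by auto
    then have "grid_sep B j \<le> dist p q"
      using grid_separated[OF B p(1), of q] q(2) by (auto simp: P_def)
    then have "r j \<le> dist p q / C" using C by (simp add: r_def divide_right_mono)
    also have "\<dots> \<le> dist (g p) b"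
      unfolding q(1) using cube pP q(2) by (intro lo) auto
    finally show "r j \<le> dist (g p) b" .
  qed (use compact_imp_bounded[OF cK] in \<open>auto simp: K_def\<close>)
  have sep: "\<omega> p = \<omega>' p"
    if "p \<in> grid B j" "hausdorff_dist (K \<omega>) (K \<omega>') < r j" for j p \<omega> \<omega>'
    using sep1[OF that(1), of \<omega> \<omega>'] sep1[OF that(1), of \<omega>' \<omega>] that(2)
    by (auto simp: hausdorff_dist_commute)

  show ?thesis
  proof (rule Lambda_pos_mass_distribution[OF prob_space_fair_coins KX])
    show "0 < r J / 2" using r_pos[of J] by simp
    fix E assume E: "E \<subseteq> mspace ?m" "Metric_space.mbounded (mspace ?m) (mdist ?m) E"
      "mdiam ?m E \<le> r J / 2"
    define \<delta> where "\<delta> = mdiam ?m E"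
    have \<delta>: "\<delta> < r J" using E(3) r_pos[of J] by (simp add: \<delta>_def)
    show "\<exists>A\<in>sets fair_coins. {\<omega> \<in> space fair_coins. K \<omega> \<in> E} \<subseteq> A \<and>
        emeasure fair_coins A \<le> ennreal (pow_exp s (mdiam ?m E))"
    proof (cases "\<exists>\<omega>. K \<omega> \<in> E")
      case False
      then show ?thesis by (intro bexI[of _ "{}"]) auto
    next
      case True
      then obtain \<omega>\<^sub>0 where \<omega>\<^sub>0: "K \<omega>\<^sub>0 \<in> E" by blast
      \<comment> \<open>Membership in \<open>E\<close> forces agreement with \<open>\<omega>\<^sub>0\<close> on the coins of every level with \<open>\<delta> < r j\<close>.\<close>
      define A where "A j = {\<omega>. \<forall>p\<in>(grid B j :: (real^'n) set). \<omega> p = \<omega>\<^sub>0 p}" for j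
      have A_sets: "A j \<in> sets fair_coins" for j
        unfolding A_def by (intro fair_coins_cylinder_sets finite_grid[OF B])
      have A_mass: "emeasure fair_coins (A j) = ennreal ((1/2) ^ ((B ^ j) ^ ?n))" for j
        unfolding A_def
        by (simp only: emeasure_fair_coins_cylinder[OF finite_grid[OF B]] card_grid[OF B])
      have sub: "{\<omega> \<in> space fair_coins. K \<omega> \<in> E} \<subseteq> A j" if "\<delta> < r j" for j
      proof
        fix \<omega> assume "\<omega> \<in> {\<omega> \<in> space fair_coins. K \<omega> \<in> E}"
        then have "mdist ?m (K \<omega>) (K \<omega>\<^sub>0) \<le> \<delta>"
          unfolding \<delta>_def using \<omega>\<^sub>0 by (intro mdist_le_mdiam E(2)) auto
        then have "hausdorff_dist (K \<omega>) (K \<omega>\<^sub>0) < r j"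
          using that by (simp add: mdist_hyperspace[OF X])
        then show "\<omega> \<in> A j" unfolding A_def using sep by blast
      qed
      show ?thesis
      proof (cases "0 < \<delta>")
        case False
        \<comment> \<open>The gauge vanishes at diameter \<open>0\<close>, so a null set is needed: all coins are fixed.\<close>
        define A' where "A' = (\<Inter>j. A j)"
        have A'_sets: "A' \<in> sets fair_coins"
          unfolding A'_def using A_sets by auto
        have "emeasure fair_coins A' \<le> ennreal ((1/2) ^ ((B ^ j) ^ ?n))" for j
          unfolding A_mass[symmetric] A'_def using A_sets by (intro emeasure_mono) auto
        moreover have "(1/2 :: real) ^ ((B ^ j) ^ ?n) \<le> (1/2) ^ j" for j
        proof (rule power_decreasing)
          have "j \<le> B ^ j" using B by (meson le_trans less_imp_le less_exp power_mono zero_le)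
          also have "\<dots> \<le> (B ^ j) ^ ?n"
            using B self_le_power[of "B ^ j" "CARD('n)"] by (simp add: one_le_power)
          finally show "j \<le> (B ^ j) ^ ?n" .
        qed auto
        ultimately have "emeasure fair_coins A' \<le> ennreal ((1/2) ^ j)" for j
          by (meson ennreal_leI order_trans)
        moreover have "(\<lambda>j. ennreal ((1/2) ^ j)) \<longlonglongrightarrow> ennreal 0"
          by (intro tendsto_ennrealI LIMSEQ_power_zero) auto
        ultimately have "emeasure fair_coins A' \<le> 0"
          using LIMSEQ_le_const by fastforce
        moreover have "{\<omega> \<in> space fair_coins. K \<omega> \<in> E} \<subseteq> A'"
          unfolding A'_def using sub r_pos False by (meson INT_greatest linorder_not_less order_le_less_trans)
        ultimately show ?thesis using A'_sets by (intro bexI[of _ A']) auto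
      next
        case True
        \<comment> \<open>Pick the level \<open>j\<close> with \<open>r (Suc j) \<le> \<delta> < r j\<close>; the halved bound on the diameter
          guarantees \<open>J \<le> j\<close>.\<close>
        have "\<exists>k. r k \<le> \<delta>"
          using order_tendstoD(2)[OF r_0 True] by (auto simp: eventually_sequentially intro: less_imp_le)
        define k where "k = (LEAST k. r k \<le> \<delta>)"
        have k: "r k \<le> \<delta>" unfolding k_def using \<open>\<exists>k. r k \<le> \<delta>\<close> by (rule LeastI_ex)
        have kJ: "J < k"
          using k \<delta> r_mono[of k J] by (meson linorder_not_le order_le_less_trans order_less_irrefl)
        then obtain j where j: "k = Suc j" "J \<le> j" by (cases k) auto
        have "\<delta> < r j"
          using not_less_Least[of j "\<lambda>k. r k \<le> \<delta>"] j(1) by (simp add: k_def)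
        have "(1/2::real) ^ N = exp (- (ln 2 * real N))" for N :: nat
          by (simp add: exp_minus exp_of_nat2_mult power_one_over inverse_eq_divide)
        then have "(1/2::real) ^ ((B ^ j) ^ ?n) = exp (- (ln 2 * real ((B ^ j) ^ ?n)))" .
        also have "\<dots> \<le> exp (- ((1 / r (Suc j)) powr s))"
          using J[OF j(2)] by (simp add: r_def)
        also have "\<dots> \<le> exp (- ((1 / \<delta>) powr s))"
          using k r_pos[of k] True s(1) unfolding j(1)
          by (simp add: powr_mono2 frac_le)
        also have "\<dots> = pow_exp s \<delta>" using True by (simp add: pow_exp_def)
        finally show ?thesis
          using sub[OF \<open>\<delta> < r j\<close>] A_sets[of j] A_mass[of j]
          by (intro bexI[of _ "A j"]) (simp_all add: \<delta>_def ennreal_leI)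
      qed
    qed
  qed
qed

section \<open>The critical parameter of the hyperspace\<close>

text \<open>The image of a chart is open, so it contains a small cube, and the inverse chart composed with a
similarity is the required embedding.\<close>

lemma metric_manifold_contains_cube:
  fixes X :: "'a::metric_space set"
  assumes M: "metric_manifold TYPE('n::finite) X" and "X \<noteq> {}"
  shows "\<exists>g :: real^'n \<Rightarrow> 'a. g ` cbox 0 1 \<subseteq> X \<and> bi_lipschitz_on (cbox 0 1) g"
proof -
  obtain x where "x \<in> X" using assms(2) by blast
  then obtain U and \<phi> :: "'a \<Rightarrow> real^'n" where U: "openin (top_of_set X) U" "x \<in> U"
      "open (\<phi> ` U)" and bl: "bi_lipschitz_on U \<phi>"
    using M unfolding metric_manifold_def by blast
  obtain C where C: "C \<ge> 1"
    and lo: "\<And>x y. x \<in> U \<Longrightarrow> y \<in> U \<Longrightarrow> dist x y \<le> C * dist (\<phi> x) (\<phi> y)"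
    and hi: "\<And>x y. x \<in> U \<Longrightarrow> y \<in> U \<Longrightarrow> dist (\<phi> x) (\<phi> y) \<le> C * dist x y"
    using bl by (auto simp: bi_lipschitz_on_def field_simps)
  obtain e where e: "0 < e" "ball (\<phi> x) e \<subseteq> \<phi> ` U"
    using U(2,3) open_contains_ball by blast
  define a where "a = e / (real CARD('n) + 1)"
  have a: "0 < a" "a * CARD('n) < e" using e by (auto simp: a_def field_simps)
  define h where "h v = \<phi> x + a *\<^sub>R v" for v :: "real^'n"
  have hU: "h v \<in> \<phi> ` U" if "v \<in> cbox 0 1" for v
  proof -
    have "(\<Sum>i\<in>UNIV. \<bar>v $ i\<bar>) \<le> real CARD('n) * 1"
      using that by (intro sum_bounded_above) (auto simp: mem_box_cart)
    then have "norm v \<le> CARD('n)" using norm_le_l1_cart[of v] by simp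
    then have "a * norm v \<le> a * CARD('n)" using a by (intro mult_left_mono) auto
    moreover have "dist (\<phi> x) (h v) = a * norm v" using a by (simp add: h_def dist_norm)
    ultimately have "h v \<in> ball (\<phi> x) e" using a unfolding mem_ball by linarith
    then show ?thesis using e by blast
  qed
  define g where "g v = inv_into U \<phi> (h v)" for v
  have gU: "g v \<in> U" and \<phi>g: "\<phi> (g v) = h v" if "v \<in> cbox 0 1" for v
    using hU[OF that] by (auto simp: g_def inv_into_into f_inv_into_f)
  have dh: "dist (h v) (h w) = a * dist v w" for v w
    using a by (simp add: h_def dist_norm flip: scaleR_diff_right)
  define D where "D = max (C * a) (C / a)"
  have D: "D \<ge> 1"
  proof (cases "a \<ge> 1")
    case True
    then have "1 * 1 \<le> C * a" using C by (intro mult_mono) auto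
    then show ?thesis by (simp add: D_def)
  next
    case False
    then have "1 \<le> C / a" using C a by (simp add: field_simps)
    then show ?thesis by (simp add: D_def)
  qed
  have "bi_lipschitz_on (cbox 0 1) g"
    unfolding bi_lipschitz_on_def
  proof (intro exI[of _ D] conjI ballI D)
    fix v w :: "real^'n" assume vw: "v \<in> cbox 0 1" "w \<in> cbox 0 1"
    have "dist (g v) (g w) \<le> C * a * dist v w"
      using lo[OF gU gU, OF vw] by (simp add: \<phi>g vw dh)
    also have "\<dots> \<le> D * dist v w" by (intro mult_right_mono) (auto simp: D_def)
    finally show "dist (g v) (g w) \<le> D * dist v w" .
    have "a * dist v w \<le> C * dist (g v) (g w)"
      using hi[OF gU gU, OF vw] by (simp add: \<phi>g vw dh)
    then have "dist v w \<le> C / a * dist (g v) (g w)"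
      using a by (simp add: field_simps)
    also have "\<dots> \<le> D * dist (g v) (g w)" by (intro mult_right_mono) (auto simp: D_def)
    finally show "inverse D * dist v w \<le> dist (g v) (g w)"
      using D by (simp add: field_simps)
  qed
  moreover have "g ` cbox 0 1 \<subseteq> X"
    using gU U(1) openin_imp_subset[of euclidean X U] by auto
  ultimately show ?thesis by blast
qed

theorem theorem1p8:
  fixes X :: "'a::metric_space set"
  assumes "compact X" and "X \<noteq> {}"
    and "metric_manifold TYPE('n::finite) X \<or>
         (upper_Minkowski_dim X = ereal (real CARD('n)) \<and>
          (\<exists>g :: real^'n \<Rightarrow> 'a. g ` cbox 0 1 \<subseteq> X \<and> bi_lipschitz_on (cbox 0 1) g))"
  shows "power_exponential_size (hyperspace X) \<and>
         crit (hyperspace X) (mspace (hyperspace X)) = of_nat CARD('n)"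
proof -
  let ?n = "real CARD('n)" and ?m = "hyperspace X"
  obtain g :: "real^'n \<Rightarrow> 'a" where g: "g ` cbox 0 1 \<subseteq> X" "bi_lipschitz_on (cbox 0 1) g"
    using assms(3) metric_manifold_contains_cube[OF _ assms(2), where ?'n='n] by blast
  have cov: "\<forall>\<^sub>F \<epsilon> in at_right 0. covered_by X \<epsilon> (\<epsilon> powr (-t))" if t: "?n < t" for t
    using assms(3)
  proof
    assume "metric_manifold TYPE('n) X"
    then show ?thesis using t by (rule covered_by_manifold[OF assms(1)])
  next
    assume "upper_Minkowski_dim X = ereal ?n \<and>
        (\<exists>g :: real^'n \<Rightarrow> 'a. g ` cbox 0 1 \<subseteq> X \<and> bi_lipschitz_on (cbox 0 1) g)"
    then show ?thesis
      using t by (intro covered_by_Minkowski assms(1)) auto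
  qed
  have pos: "0 < Lambda ?m (pow_exp s) (mspace ?m)" if "0 < s" "s < ?n" for s
    using Lambda_hyperspace_pos[OF assms(1) g that] by (simp add: mspace_hyperspace assms(1))
  have zero: "Lambda ?m (pow_exp s) (mspace ?m) = 0" if s: "?n < s" for s
  proof -
    obtain t where t: "?n < t" "t < s" using dense[OF s] by blast
    then have "0 < t" by (meson of_nat_0_le_iff order_le_less_trans)
    then show ?thesis
      using Lambda_hyperspace_eq_0[OF assms(1) _ t(2) cov[OF t(1)]]
      by (simp add: mspace_hyperspace assms(1))
  qed
  have crit: "crit ?m (mspace ?m) = ennreal ?n"
  proof (rule antisym)
    show "crit ?m (mspace ?m) \<le> ennreal ?n"
      unfolding crit_def
    proof (rule Sup_least, clarify)
      fix s assume "0 < Lambda ?m (pow_exp s) (mspace ?m)"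
      then have "s \<le> ?n" using zero[of s] by (cases "?n < s") auto
      then show "ennreal s \<le> ennreal ?n" by (rule ennreal_leI)
    qed
    show "ennreal ?n \<le> crit ?m (mspace ?m)"
    proof (rule ennreal_le_epsilon)
      fix e :: real assume e: "0 < e"
      obtain s where s: "max 0 (?n - e) < s" "s < ?n"
        using dense[of "max 0 (?n - e)" ?n] e by auto
      have "ennreal s \<le> crit ?m (mspace ?m)"
        unfolding crit_def using s pos[of s] by (intro Sup_upper) auto
      moreover have "ennreal ?n \<le> ennreal (s + e)" using s by (intro ennreal_leI) auto
      ultimately show "ennreal ?n \<le> crit ?m (mspace ?m) + ennreal e"
        using s e by (simp add: ennreal_plus add_right_mono order_trans)
    qed
  qed
  then show ?thesis
    by (simp add: power_exponential_size_def ennreal_of_nat_eq_real_of_nat)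
qed

end
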